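(* Let $m$ and $S$ be fixed positive integers. For each integer $N \ge S$, let $X^{(N)}(m)$ be a random matrix distributed according to the uniform distribution (equivalently, the normalized Haar measure) on the finite group $\mathrm{GL}_N(\mathbb{Z}/m\mathbb{Z})$, and let $X^{(N)}(m)[S] = (X^{(N)}(m)_{ij})_{1\le i,j\le S}$ be its upper-left $S\times S$ corner. Then, as $N\to\infty$, the probability distribution of $X^{(N)}(m)[S]$ converges weakly to the uniform distribution on the finite set $M_S(\mathbb{Z}/m\mathbb{Z})$.
   Context: $M_N(\mathbb{Z}/m\mathbb{Z})$ is the ring of $N\times N$ matrices over $\mathbb{Z}/m\mathbb{Z}$, and $\mathrm{GL}_N(\mathbb{Z}/m\mathbb{Z})$ is the group of those whose determinant is a unit of $\mathbb{Z}/m\mathbb{Z}$. The finite set $M_S(\mathbb{Z}/m\mathbb{Z})$ carries the discrete topology. *)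

theory Defs
  imports
    "HOL-Algebra.IntRing"
    "HOL-Probability.Probability"
    "Jordan_Normal_Form.Matrix"
begin

text \<open>
  Matrices are those of \<^theory>\<open>Jordan_Normal_Form.Matrix\<close>, with rows and columns indexed
  from 0. That library's determinant lives in the type class of commutative rings with
  \<open>0 \<noteq> 1\<close> and so excludes \<open>\<int>/m\<int>\<close> for \<open>m = 1\<close>; here the coefficients
  come from a commutative ring given by a carrier, such as \<^term>\<open>ZFact m\<close>.
\<close>

definition matrices :: "('a, 'b) ring_scheme \<Rightarrow> nat \<Rightarrow> 'a mat set" where
  "matrices R n = {A \<in> carrier_mat n n. \<forall>i<n. \<forall>j<n. A $$ (i, j) \<in> carrier R}"

definition ring_det :: "('a, 'b) ring_scheme \<Rightarrow> 'a mat \<Rightarrow> 'a" where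
  "ring_det R A =
    (\<Oplus>\<^bsub>R\<^esub>p\<in>{p. p permutes {0..<dim_row A}}.
      [sign p] \<cdot>\<^bsub>R\<^esub> (\<Otimes>\<^bsub>R\<^esub>i\<in>{0..<dim_row A}. A $$ (i, p i)))"

definition GL :: "('a, 'b) ring_scheme \<Rightarrow> nat \<Rightarrow> 'a mat set" where
  "GL R n = {A \<in> matrices R n. ring_det R A \<in> Units R}"

definition corner :: "nat \<Rightarrow> 'a mat \<Rightarrow> 'a mat" where
  "corner s A = mat s s (\<lambda>(i, j). A $$ (i, j))"

text \<open>
  Weak convergence for measures on the Borel sets of a topological space. The library's
  \<^const>\<open>weak_conv_m\<close> covers only measures on the real line.
\<close>

definition weak_conv_top :: "'a topology \<Rightarrow> (nat \<Rightarrow> 'a measure) \<Rightarrow> 'a measure \<Rightarrow> bool" where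
  "weak_conv_top T \<mu> \<nu> \<longleftrightarrow>
    (\<forall>f. continuous_map T euclideanreal f \<and> bounded (f ` topspace T) \<longrightarrow>
      (\<lambda>n. \<integral>x. f x \<partial>\<mu> n) \<longlonglongrightarrow> (\<integral>x. f x \<partial>\<nu>))"

end

theory Submission
  imports
    Defs
    "HOL-Library.Real_Mod"
    "HOL-Number_Theory.Cong"
    "Jordan_Normal_Form.Determinant"
begin

text \<open>
  Fourier analysis on \<open>M\<^sub>S(\<int>/m\<int>)\<close>: every character sum over \<open>GL\<^sub>N(\<int>/m\<int>)\<close> belonging to a
  nonzero frequency matrix \<open>V\<close> has to be small compared with the order of the group. Let \<open>v\<close> be a
  nonzero column of \<open>V\<close>, with index \<open>q < S\<close>, and let \<open>w\<close> be the combination of the first \<open>S\<close> rows of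
  \<open>A\<close> with coefficients \<open>v\<close>. Adding column \<open>j \<ge> S\<close> of \<open>A\<close> to column \<open>q\<close> preserves the group and
  multiplies the character by \<open>exp(2\<pi>i w\<^sub>j/m)\<close>, so the matrices with some \<open>w\<^sub>j \<noteq> 0\<close>, \<open>j \<ge> S\<close>,
  contribute nothing. For the others \<open>w\<close> is supported on the first \<open>S\<close> columns; as \<open>w \<noteq> 0\<close> and column
  permutations preserve the group, they form at most a fraction \<open>1/\<lfloor>N/S\<rfloor>\<close> of it.
\<close>

section \<open>Additive characters of the residues\<close>

text \<open>\<open>f x\<close> equals \<open>f (T x) / (g (T x) - 1) - f x / (g x - 1)\<close>, a
  difference that cancels when summed along the bijection \<open>T\<close>. The eigenvalue
  \<open>g\<close> may vary between orbits, as long as \<open>T\<close> preserves it.\<close>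

lemma sum_eq_0_if_bij_betw_eigenfunction:
  fixes f g :: "'a \<Rightarrow> 'b :: field"
  assumes "bij_betw T A A"
    and f: "\<And>x. x \<in> A \<Longrightarrow> f (T x) = g x * f x"
    and g: "\<And>x. x \<in> A \<Longrightarrow> g (T x) = g x" "\<And>x. x \<in> A \<Longrightarrow> g x \<noteq> 1"
  shows "sum f A = 0"
proof -
  have "(\<Sum>x\<in>A. f x / (g x - 1)) = (\<Sum>x\<in>A. f (T x) / (g (T x) - 1))"
    using sum.reindex_bij_betw[OF assms(1), of "\<lambda>x. f x / (g x - 1)"] by simp
  also have "\<dots> = (\<Sum>x\<in>A. f x + f x / (g x - 1))"
  proof (rule sum.cong[OF refl])
    fix x assume "x \<in> A"
    then have "g x - 1 \<noteq> 0" using g(2) by simp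
    then show "f (T x) / (g (T x) - 1) = f x + f x / (g x - 1)"
      using f[OF \<open>x \<in> A\<close>] g(1)[OF \<open>x \<in> A\<close>] by (simp add: field_simps)
  qed
  finally show ?thesis by (simp add: sum.distrib)
qed

text \<open>The additive character exp(2 pi i k / m), taken on all integers so that arguments may
  stay unreduced.\<close>

definition root_char :: "int \<Rightarrow> int \<Rightarrow> complex" where
  "root_char m k = cis (2 * pi * (k / m))"

lemma norm_root_char [simp]: "norm (root_char m k) = 1"
  by (simp add: root_char_def)

lemma root_char_0 [simp]: "root_char m 0 = 1"
  by (simp add: root_char_def)

lemma root_char_add: "root_char m (k + l) = root_char m k * root_char m l"
  by (simp add: root_char_def cis_mult add_divide_distrib distrib_left)

lemma root_char_sum:
  "finite I \<Longrightarrow> root_char m (\<Sum>x\<in>I. f x) = (\<Prod>x\<in>I. root_char m (f x))"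
  by (induction I rule: finite_induct) (simp_all add: root_char_add)

lemma root_char_eq_1_iff:
  assumes "m > 0"
  shows "root_char m k = 1 \<longleftrightarrow> m dvd k"
proof -
  have "root_char m k = 1 \<longleftrightarrow> (\<exists>n. real_of_int k = real_of_int (m * n))"
    using assms unfolding root_char_def cis_eq_1_iff by (auto simp: field_simps)
  then show ?thesis unfolding of_int_eq_iff dvd_def .
qed

lemma root_char_cong:
  assumes "m > 0" "[k = l] (mod m)"
  shows "root_char m k = root_char m l"
proof -
  have "root_char m (k - l) = 1"
    using assms by (simp add: root_char_eq_1_iff cong_iff_dvd_diff)
  then show ?thesis using root_char_add[of m "k - l" l] by simp
qed

lemma bij_betw_Suc_mod:
  fixes m :: int
  assumes "m > 0"
  shows "bij_betw (\<lambda>v. (v + 1) mod m) {0..<m} {0..<m}"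
proof -
  have inj: "inj_on (\<lambda>v. (v + 1) mod m) {0..<m}"
  proof
    fix v w assume vw: "v \<in> {0..<m}" "w \<in> {0..<m}" "(v + 1) mod m = (w + 1) mod m"
    then have "[v + 1 = w + 1] (mod m)" by (simp add: cong_def)
    then have "[v = w] (mod m)" by (simp add: cong_add_rcancel)
    with vw show "v = w" by (simp add: cong_def)
  qed
  moreover have "(\<lambda>v. (v + 1) mod m) ` {0..<m} \<subseteq> {0..<m}" using assms by auto
  ultimately show ?thesis by (simp add: bij_betw_def endo_inj_surj)
qed

text \<open>Orthogonality of characters: if \<open>m\<close> does not divide \<open>a\<close>,
  replacing \<open>v\<close> by \<open>v + 1\<close> multiplies every summand by the constant
  \<open>root_char m a\<close>, which is not 1.\<close>

lemma sum_root_char: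
  assumes "m > 0"
  shows "(\<Sum>v\<in>{0..<m}. root_char m (v * a)) = (if m dvd a then of_int m else 0)"
proof (cases "m dvd a")
  case True
  then have "root_char m (v * a) = 1" for v using assms by (simp add: root_char_eq_1_iff)
  then show ?thesis using assms True by simp
next
  case False
  have "(\<Sum>v\<in>{0..<m}. root_char m (v * a)) = 0"
  proof (rule sum_eq_0_if_bij_betw_eigenfunction[OF bij_betw_Suc_mod[OF assms],
        where g = "\<lambda>_. root_char m a"])
    fix v
    have "[(v + 1) mod m * a = a + v * a] (mod m)"
      by (simp add: cong_def mod_mult_left_eq distrib_right add.commute)
    then show "root_char m ((v + 1) mod m * a) = root_char m a * root_char m (v * a)"
      unfolding root_char_add[symmetric] by (rule root_char_cong[OF assms])
  qed (use assms False in \<open>simp_all add: root_char_eq_1_iff\<close>)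
  then show ?thesis using False by simp
qed

text \<open>Fourier inversion: orthogonality turns each congruence into a sum over \<open>v\<close>,
  and expanding the product over \<open>I\<close> gives one summand for each frequency
  \<open>V\<close>.\<close>

lemma card_cong_eq_sum_root_char:
  fixes m :: int and a :: "'b \<Rightarrow> 'i \<Rightarrow> int"
  assumes "m > 0" "finite I" "finite \<Omega>"
  shows "of_int m ^ card I * of_nat (card {\<omega>\<in>\<Omega>. \<forall>x\<in>I. [a \<omega> x = b x] (mod m)}) =
    (\<Sum>V\<in>I \<rightarrow>\<^sub>E {0..<m}. root_char m (- (\<Sum>x\<in>I. V x * b x)) *
      (\<Sum>\<omega>\<in>\<Omega>. root_char m (\<Sum>x\<in>I. V x * a \<omega> x)))" (is "?L = ?R")
proof -
  have "?L = (\<Sum>\<omega>\<in>\<Omega>. if \<forall>x\<in>I. [a \<omega> x = b x] (mod m) then of_int m ^ card I else 0)"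
    using assms by (simp add: sum.If_cases Int_def conj_commute)
  also have "\<dots> = (\<Sum>\<omega>\<in>\<Omega>. \<Prod>x\<in>I. \<Sum>v\<in>{0..<m}. root_char m (v * (a \<omega> x - b x)))"
  proof (rule sum.cong[OF refl])
    fix \<omega>
    show "(if \<forall>x\<in>I. [a \<omega> x = b x] (mod m) then of_int m ^ card I else 0) =
        (\<Prod>x\<in>I. \<Sum>v\<in>{0..<m}. root_char m (v * (a \<omega> x - b x)))"
      using assms unfolding sum_root_char[OF assms(1)] cong_iff_dvd_diff
      by (auto simp: prod_zero_iff)
  qed
  also have "\<dots> = (\<Sum>\<omega>\<in>\<Omega>. \<Sum>V\<in>I \<rightarrow>\<^sub>E {0..<m}. root_char m (\<Sum>x\<in>I. V x * (a \<omega> x - b x)))"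
    using assms by (simp add: prod_sum_PiE root_char_sum)
  also have "\<dots> = ?R"
    unfolding sum.swap[of _ \<Omega>] sum_distrib_left root_char_add[symmetric]
    by (simp add: algebra_simps sum_subtractf)
  finally show ?thesis .
qed

text \<open>The zero frequency contributes the main term.\<close>

lemma card_cong_approx:
  fixes m :: int and a :: "'b \<Rightarrow> 'i \<Rightarrow> int" and K :: real
  assumes "m > 0" "finite I" "finite \<Omega>"
    and K: "\<And>V. V \<in> I \<rightarrow>\<^sub>E {0..<m} \<Longrightarrow> \<exists>x\<in>I. V x \<noteq> 0 \<Longrightarrow>
      norm (\<Sum>\<omega>\<in>\<Omega>. root_char m (\<Sum>x\<in>I. V x * a \<omega> x)) \<le> K"
    and "K \<ge> 0"
  shows "\<bar>of_int m ^ card I * real (card {\<omega>\<in>\<Omega>. \<forall>x\<in>I. [a \<omega> x = b x] (mod m)}) - real (card \<Omega>)\<bar>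
    \<le> of_int m ^ card I * K"
proof -
  let ?W = "I \<rightarrow>\<^sub>E {0..<m}"
  let ?t = "\<lambda>V. root_char m (- (\<Sum>x\<in>I. V x * b x)) * (\<Sum>\<omega>\<in>\<Omega>. root_char m (\<Sum>x\<in>I. V x * a \<omega> x))"
  let ?c = "card {\<omega>\<in>\<Omega>. \<forall>x\<in>I. [a \<omega> x = b x] (mod m)}"
  \<comment> \<open>Frequencies are extensional functions, so the zero frequency has to be
    restricted to \<open>I\<close>.\<close>
  define Z where "Z = (\<lambda>x\<in>I. 0 :: int)"
  have Z: "Z \<in> ?W" using assms(1) by (auto simp: Z_def)
  have fin: "finite ?W" using assms(2) by (intro finite_PiE) auto
  have tZ: "?t Z = of_nat (card \<Omega>)" by (simp add: Z_def)
  have "of_int m ^ card I * of_nat ?c - of_nat (card \<Omega>) = (\<Sum>V\<in>?W - {Z}. ?t V)"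
    unfolding card_cong_eq_sum_root_char[OF assms(1-3)]
    using sum.remove[OF fin Z, of ?t] tZ by simp
  also have "norm \<dots> \<le> (\<Sum>V\<in>?W - {Z}. K)"
  proof (rule sum_norm_le)
    fix V assume V: "V \<in> ?W - {Z}"
    have "\<exists>x\<in>I. V x \<noteq> 0"
    proof (rule ccontr)
      assume "\<not> ?thesis"
      then have "V = Z" using V by (auto simp: Z_def fun_eq_iff PiE_def extensional_def)
      then show False using V by simp
    qed
    then show "norm (?t V) \<le> K" using K V by (simp add: norm_mult)
  qed
  \<comment> \<open>Counting the zero frequency again only enlarges the bound, because
    \<open>K\<close> is nonnegative.\<close>
  also have "\<dots> \<le> card ?W * K"
    using assms(5) fin by (auto intro!: mult_right_mono card_mono)
  also have "\<dots> = of_int m ^ card I * K"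
    using assms(1,2) by (simp add: card_PiE)
  finally have "norm (of_real (of_int m ^ card I * real ?c - real (card \<Omega>)) :: complex) \<le> of_int m ^ card I * K"
    by simp
  then show ?thesis unfolding norm_of_real .
qed

section \<open>Invertible matrices of residues\<close>

text \<open>Integer representatives make the determinant theory of integer matrices available for
  every positive \<open>m\<close>, including \<open>m = 1\<close>.\<close>

definition residue_mats :: "int \<Rightarrow> nat \<Rightarrow> int mat set" where
  "residue_mats m n = {A \<in> carrier_mat n n. \<forall>i<n. \<forall>j<n. A $$ (i, j) \<in> {0..<m}}"

definition residue_GL :: "int \<Rightarrow> nat \<Rightarrow> int mat set" where
  "residue_GL m n = {A \<in> residue_mats m n. coprime (Determinant.det A) m}"

lemma residue_GL_carrier: "A \<in> residue_GL m n \<Longrightarrow> A \<in> carrier_mat n n"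
  by (simp add: residue_GL_def residue_mats_def)

lemma residue_GL_entry: "A \<in> residue_GL m n \<Longrightarrow> i < n \<Longrightarrow> j < n \<Longrightarrow> A $$ (i, j) \<in> {0..<m}"
  by (simp add: residue_GL_def residue_mats_def)

lemma bij_betw_mat_residue_mats:
  "bij_betw (mat n n) (({..<n} \<times> {..<n}) \<rightarrow>\<^sub>E {0..<m}) (residue_mats m n)"
  (is "bij_betw _ ?F _")
proof (rule bij_betw_byWitness[where f' = "\<lambda>A. restrict (($$) A) ({..<n} \<times> {..<n})"])
  show "\<forall>f\<in>?F. restrict (($$) (mat n n f)) ({..<n} \<times> {..<n}) = f"
  proof
    fix f assume "f \<in> ?F"
    then show "restrict (($$) (mat n n f)) ({..<n} \<times> {..<n}) = f"
      by (intro extensionalityI[of _ "{..<n} \<times> {..<n}"]) (auto simp: PiE_def)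
  qed
  show "\<forall>A\<in>residue_mats m n. mat n n (restrict (($$) A) ({..<n} \<times> {..<n})) = A"
    by (auto simp: residue_mats_def)
  show "mat n n ` ?F \<subseteq> residue_mats m n"
  proof
    fix A assume "A \<in> mat n n ` ?F"
    then obtain f where f: "f \<in> ?F" "A = mat n n f" by blast
    have "f (i, j) \<in> {0..<m}" if "i < n" "j < n" for i j
      using PiE_mem[OF f(1), of "(i, j)"] that by simp
    then show "A \<in> residue_mats m n" by (simp add: residue_mats_def f(2))
  qed
  show "(\<lambda>A. restrict (($$) A) ({..<n} \<times> {..<n})) ` residue_mats m n \<subseteq> ?F"
    by (auto simp: residue_mats_def)
qed

lemma finite_residue_mats: "finite (residue_mats m n)"
  using bij_betw_finite[OF bij_betw_mat_residue_mats] by (simp add: finite_PiE)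

lemma card_residue_mats: "m > 0 \<Longrightarrow> card (residue_mats m n) = nat m ^ (n * n)"
  using bij_betw_same_card[OF bij_betw_mat_residue_mats, of n m]
  by (simp add: card_PiE card_cartesian_product)

lemma finite_residue_GL: "finite (residue_GL m n)"
  by (rule finite_subset[OF _ finite_residue_mats]) (auto simp: residue_GL_def)

text \<open>By the Leibniz formula the determinant is a polynomial in the entries with integer
  coefficients.\<close>

lemma cong_det:
  fixes A B :: "int mat"
  assumes "A \<in> carrier_mat n n" "B \<in> carrier_mat n n"
    and "\<And>i j. i < n \<Longrightarrow> j < n \<Longrightarrow> [A $$ (i, j) = B $$ (i, j)] (mod m)"
  shows "[Determinant.det A = Determinant.det B] (mod m)"
  unfolding det_def'[OF assms(1)] det_def'[OF assms(2)]
proof (intro cong_sum cong_mult cong_refl cong_prod)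
  fix p i assume "p \<in> {p. p permutes {0..<n}}" "i \<in> {0..<n}"
  then have "p i < n" using permutes_in_image[of p "{0..<n}" i] by auto
  then show "[A $$ (i, p i) = B $$ (i, p i)] (mod m)"
    using assms(3) \<open>i \<in> {0..<n}\<close> by simp
qed

text \<open>Allows an operation on matrices to leave the range of representatives, provided the
  entries are reduced afterwards.\<close>

lemma mod_mat_in_residue_GL:
  fixes A :: "int mat"
  assumes "m > 0" "A \<in> carrier_mat n n" "coprime (Determinant.det A) m"
  shows "map_mat (\<lambda>x. x mod m) A \<in> residue_GL m n"
proof -
  have "[Determinant.det (map_mat (\<lambda>x. x mod m) A) = Determinant.det A] (mod m)"
    using assms(2) by (intro cong_det) (auto simp: cong_def)
  then have "coprime (Determinant.det (map_mat (\<lambda>x. x mod m) A)) m"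
    using assms(3) cong_imp_coprime cong_sym by blast
  then show ?thesis
    using assms by (auto simp: residue_GL_def residue_mats_def)
qed

definition row_comb :: "nat \<Rightarrow> (nat \<Rightarrow> int) \<Rightarrow> int mat \<Rightarrow> nat \<Rightarrow> int" where
  "row_comb s v A j = (\<Sum>i<s. v i * A $$ (i, j))"

text \<open>Multiplying the row vector of combinations by the adjugate returns \<open>det A\<close>
  times the coefficients, and \<open>det A\<close> is invertible modulo \<open>m\<close>. So nonzero
  coefficients never give a combination that vanishes modulo \<open>m\<close>.\<close>

lemma dvd_coeff_if_dvd_row_comb:
  assumes A: "A \<in> carrier_mat n n" and cop: "coprime (Determinant.det A) m" and "s \<le> n"
    and w: "\<And>j. j < n \<Longrightarrow> m dvd row_comb s v A j" and "p < s"
  shows "m dvd v p"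
proof -
  let ?B = "adj_mat A"
  \<comment> \<open>\<open>det A\<close> times the identity is diagonal, so only
    \<open>i = p\<close> survives.\<close>
  have "v p * Determinant.det A = (\<Sum>i<s. v i * (Determinant.det A \<cdot>\<^sub>m 1\<^sub>m n) $$ (i, p))"
    using assms by (simp add: if_distrib if_distribR sum.delta cong: if_cong)
  also have "\<dots> = (\<Sum>i<s. v i * (A * ?B) $$ (i, p))"
    using adj_mat(2)[OF A] by simp
  also have "\<dots> = (\<Sum>i<s. v i * (\<Sum>j<n. A $$ (i, j) * ?B $$ (j, p)))"
    using A adj_mat(1)[OF A] assms by (intro sum.cong)
      (auto simp: scalar_prod_def atLeast0LessThan)
  also have "\<dots> = (\<Sum>j<n. row_comb s v A j * ?B $$ (j, p))"
    unfolding row_comb_def sum_distrib_left sum_distrib_right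
    by (subst sum.swap) (simp add: mult.assoc)
  also have "m dvd \<dots>"
    using w by (intro dvd_sum) auto
  finally show ?thesis
    using cop by (simp add: coprime_dvd_mult_left_iff coprime_commute)
qed

section \<open>Character sums over the general linear group\<close>

text \<open>The column operation \<open>T\<close> permutes the index set and multiplies each summand
  by a root of unity other than 1. That factor is invariant under \<open>T\<close>, so the
  eigenfunction argument applies although the added column depends on \<open>A\<close>.\<close>

lemma sum_residue_GL_root_char_eq_0:
  fixes m :: int and V :: "nat \<times> nat \<Rightarrow> int"
  assumes "m > 0" "s \<le> n" "q < s"
  defines "w \<equiv> row_comb s (\<lambda>i. V (i, q))"
  shows "(\<Sum>A\<in>{A \<in> residue_GL m n. \<exists>j\<in>{s..<n}. \<not> m dvd w A j}.
    root_char m (\<Sum>x\<in>{..<s} \<times> {..<s}. V x * A $$ x)) = 0"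
proof -
  let ?\<Gamma> = "{A \<in> residue_GL m n. \<exists>j\<in>{s..<n}. \<not> m dvd w A j}"
  let ?I = "{..<s} \<times> {..<s}"
  \<comment> \<open>Taking the least admissible column makes the choice a function of the entries in
    rows below \<open>s\<close> and columns from \<open>s\<close> on, which \<open>T\<close> leaves
    alone since \<open>q < s\<close>.\<close>
  define J where "J A = (LEAST j. s \<le> j \<and> j < n \<and> \<not> m dvd w A j)" for A
  define T where "T A = map_mat (\<lambda>x. x mod m) (addcol 1 q (J A) A)" for A
  have J: "s \<le> J A \<and> J A < n \<and> \<not> m dvd w A (J A)" if "A \<in> ?\<Gamma>" for A
    unfolding J_def by (rule LeastI_ex) (use that in auto)
  have entry: "T A $$ (i, k) = (if k = q then (A $$ (i, J A) + A $$ (i, q)) mod m else A $$ (i, k))"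
    if "A \<in> residue_GL m n" "i < n" "k < n" for A i k
    using that residue_GL_carrier[OF that(1)] residue_GL_entry[OF that] by (simp add: T_def)
  have T_GL: "T A \<in> residue_GL m n" if "A \<in> ?\<Gamma>" for A
  proof -
    have A: "A \<in> carrier_mat n n" "q \<noteq> J A" using that J[OF that] assms residue_GL_carrier by auto
    then have "Determinant.det (addcol 1 q (J A) A) = Determinant.det A"
      using J[OF that] by (intro det_addcol) auto
    then show ?thesis unfolding T_def
      using that A assms(1) by (intro mod_mat_in_residue_GL) (auto simp: residue_GL_def mat_addcol_def)
  qed
  have J_cong: "J A = J B" and w_cong: "\<And>j. j \<in> {s..<n} \<Longrightarrow> w A j = w B j"
    if "\<And>i k. i < s \<Longrightarrow> k \<in> {s..<n} \<Longrightarrow> A $$ (i, k) = B $$ (i, k)" for A B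
  proof -
    show w: "w A j = w B j" if "j \<in> {s..<n}" for j
      using \<open>\<And>i k. _ \<Longrightarrow> _ \<Longrightarrow> A $$ (i, k) = B $$ (i, k)\<close> that by (simp add: w_def row_comb_def)
    show "J A = J B" unfolding J_def using w by (metis atLeastLessThan_iff)
  qed
  have same: "T A $$ (i, k) = A $$ (i, k)" if "A \<in> ?\<Gamma>" "i < s" "k \<in> {s..<n}" for A i k
    using entry[of A i k] that assms by auto
  have JT: "J (T A) = J A" and wT: "\<And>j. j \<in> {s..<n} \<Longrightarrow> w (T A) j = w A j" if "A \<in> ?\<Gamma>" for A
    using J_cong[of "T A" A] w_cong[of "T A" A] same[OF that] by auto
  have endo: "T ` ?\<Gamma> \<subseteq> ?\<Gamma>"
  proof
    fix B assume "B \<in> T ` ?\<Gamma>"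
    then obtain A where A: "A \<in> ?\<Gamma>" and B: "B = T A" by blast
    have "\<exists>j\<in>{s..<n}. \<not> m dvd w (T A) j"
      using J[OF A] wT[OF A, of "J A"] by (intro bexI[of _ "J A"]) auto
    then show "B \<in> ?\<Gamma>" using T_GL[OF A] B by simp
  qed
  \<comment> \<open>\<open>T A\<close> agrees with \<open>A\<close> outside column \<open>q\<close>,
    so it determines \<open>J A\<close>. Subtracting column \<open>J A\<close> then recovers column
    \<open>q\<close> modulo \<open>m\<close>, hence exactly, as the entries are
    representatives.\<close>
  have inj: "inj_on T ?\<Gamma>"
  proof
    fix A B assume A: "A \<in> ?\<Gamma>" and B: "B \<in> ?\<Gamma>" and eq: "T A = T B"
    have GL: "A \<in> residue_GL m n" "B \<in> residue_GL m n" using A B by auto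
    have off: "A $$ (i, k) = B $$ (i, k)" if "i < n" "k < n" "k \<noteq> q" for i k
      using entry[OF GL(1) that(1,2)] entry[OF GL(2) that(1,2)] eq that(3) by simp
    have "J A = J B" using assms by (intro J_cong off) auto
    have "A $$ (i, q) = B $$ (i, q)" if "i < n" for i
    proof -
      have "q < n" using assms by simp
      have "A $$ (i, J A) = B $$ (i, J A)" using J[OF A] assms that by (intro off) auto
      then have "[A $$ (i, J A) + A $$ (i, q) = A $$ (i, J A) + B $$ (i, q)] (mod m)"
        using entry[OF GL(1) that \<open>q < n\<close>] entry[OF GL(2) that \<open>q < n\<close>] eq \<open>J A = J B\<close>
        by (simp add: cong_def)
      then have "[A $$ (i, q) = B $$ (i, q)] (mod m)" by (simp add: cong_add_lcancel)
      then show ?thesis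
        using residue_GL_entry[OF GL(1) that \<open>q < n\<close>] residue_GL_entry[OF GL(2) that \<open>q < n\<close>]
        by (simp add: cong_def)
    qed
    then have "A $$ (i, k) = B $$ (i, k)" if "i < n" "k < n" for i k
      using off that by (cases "k = q") auto
    then show "A = B"
      using residue_GL_carrier[OF GL(1)] residue_GL_carrier[OF GL(2)] by (intro eq_matI) auto
  qed
  have "finite ?\<Gamma>" using finite_residue_GL by simp
  then have bij: "bij_betw T ?\<Gamma> ?\<Gamma>" using endo inj by (simp add: bij_betw_def endo_inj_surj)
  show ?thesis
  proof (rule sum_eq_0_if_bij_betw_eigenfunction[OF bij, where g = "\<lambda>A. root_char m (w A (J A))"])
    fix A assume A: "A \<in> ?\<Gamma>"
    have sn: "i < n" if "i < s" for i using that assms by simp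
    \<comment> \<open>The increment of the exponent: within the corner, \<open>T\<close> changes
      only column \<open>q\<close>, by the entries of column \<open>J A\<close>.\<close>
    have "(\<Sum>x\<in>?I. V x * (if snd x = q then A $$ (fst x, J A) else 0)) =
        (\<Sum>i<s. \<Sum>k<s. if k = q then V (i, q) * A $$ (i, J A) else 0)"
      unfolding sum.cartesian_product by (rule sum.cong) auto
    also have "\<dots> = w A (J A)"
      using assms(3) by (simp add: w_def row_comb_def)
    finally have w: "(\<Sum>x\<in>?I. V x * (if snd x = q then A $$ (fst x, J A) else 0)) = w A (J A)" .
    have "[(\<Sum>x\<in>?I. V x * T A $$ x) =
        (\<Sum>x\<in>?I. V x * ((if snd x = q then A $$ (fst x, J A) else 0) + A $$ x))] (mod m)"
      using A entry sn by (intro cong_sum cong_mult cong_refl) (auto simp: cong_def)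
    also have "(\<Sum>x\<in>?I. V x * ((if snd x = q then A $$ (fst x, J A) else 0) + A $$ x)) =
        w A (J A) + (\<Sum>x\<in>?I. V x * A $$ x)"
      unfolding distrib_left sum.distrib w ..
    finally show "root_char m (\<Sum>x\<in>?I. V x * T A $$ x) =
        root_char m (w A (J A)) * root_char m (\<Sum>x\<in>?I. V x * A $$ x)"
      unfolding root_char_add[symmetric] by (rule root_char_cong[OF assms(1)])
    show "root_char m (w (T A) (J (T A))) = root_char m (w A (J A))"
      using JT[OF A] wT[OF A] J[OF A] by simp
    show "root_char m (w A (J A)) \<noteq> 1"
      using J[OF A] assms(1) by (simp add: root_char_eq_1_iff)
  qed
qed

text \<open>Only the matrices whose combination is supported on the first \<open>s\<close> columns
  survive, and each contributes norm 1.\<close>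

lemma norm_sum_residue_GL_root_char_le:
  fixes m :: int and V :: "nat \<times> nat \<Rightarrow> int"
  assumes "m > 0" "s \<le> n" "q < s"
  shows "norm (\<Sum>A\<in>residue_GL m n. root_char m (\<Sum>x\<in>{..<s} \<times> {..<s}. V x * A $$ x))
    \<le> card {A \<in> residue_GL m n. \<forall>j\<in>{s..<n}. m dvd row_comb s (\<lambda>i. V (i, q)) A j}"
proof -
  let ?G = "residue_GL m n"
  let ?P = "\<lambda>A. \<forall>j\<in>{s..<n}. m dvd row_comb s (\<lambda>i. V (i, q)) A j"
  let ?f = "\<lambda>A. root_char m (\<Sum>x\<in>{..<s} \<times> {..<s}. V x * A $$ x)"
  have "sum ?f ?G = sum ?f {A \<in> ?G. ?P A} + sum ?f {A \<in> ?G. \<not> ?P A}"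
    by (subst sum.union_disjoint[symmetric])
      (auto simp: finite_residue_GL intro!: arg_cong[of _ _ "sum ?f"])
  then have "sum ?f ?G = sum ?f {A \<in> ?G. ?P A}"
    using sum_residue_GL_root_char_eq_0[OF assms, of V] by simp
  also have "norm \<dots> \<le> (\<Sum>A\<in>{A \<in> ?G. ?P A}. 1)"
    by (intro sum_norm_le) simp
  finally show ?thesis by simp
qed

section \<open>Column permutations and matrices with a combination supported on one block\<close>

lemma det_permute_cols:
  fixes A :: "int mat"
  assumes "A \<in> carrier_mat n n" "p permutes {0..<n}"
  shows "Determinant.det (mat n n (\<lambda>(i, j). A $$ (i, p j))) = signof p * Determinant.det A"
proof -
  have "mat n n (\<lambda>(i, j). A $$ (i, p j)) = transpose_mat (mat n n (\<lambda>(i, j). transpose_mat A $$ (p i, j)))"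
    using assms permutes_in_image[OF assms(2)] by (intro eq_matI) auto
  then show ?thesis
    using det_permute_rows[of "transpose_mat A" n p] assms
    by (simp add: det_transpose[of _ n])
qed

lemma permute_cols_in_residue_GL:
  assumes "A \<in> residue_GL m n" "p permutes {0..<n}"
  shows "mat n n (\<lambda>(i, j). A $$ (i, p j)) \<in> residue_GL m n"
proof -
  have "coprime (signof p * Determinant.det A) m"
    using assms(1) by (simp add: residue_GL_def sign_def)
  then show ?thesis
    using assms permutes_in_image[OF assms(2)] residue_GL_entry[OF assms(1)]
      det_permute_cols[OF residue_GL_carrier[OF assms(1)] assms(2)]
    by (auto simp: residue_GL_def residue_mats_def)
qed

text \<open>Exchanges the blocks starting at 0 and at \<open>t\<close>; it is an involution when
  they are disjoint, and the identity for \<open>t = 0\<close>.\<close>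

definition swap_blocks :: "nat \<Rightarrow> nat \<Rightarrow> nat \<Rightarrow> nat" where
  "swap_blocks s t j = (if j < s then j + t else if j \<in> {t..<t + s} then j - t else j)"

lemma swap_blocks_permutes:
  assumes "t = 0 \<or> s \<le> t" "t + s \<le> n"
  shows "swap_blocks s t permutes {0..<n}"
proof (rule bij_imp_permutes)
  have "swap_blocks s t (swap_blocks s t j) = j" for j
    using assms(1) by (auto simp: swap_blocks_def)
  moreover have "swap_blocks s t j < n" if "j < n" for j
    using that assms(2) by (auto simp: swap_blocks_def)
  ultimately show "bij_betw (swap_blocks s t) {0..<n} {0..<n}"
    by (intro bij_betw_byWitness[where f' = "swap_blocks s t"]) auto
  show "swap_blocks s t j = j" if "j \<notin> {0..<n}" for j
    using that assms(2) by (simp add: swap_blocks_def)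
qed

text \<open>If a nonzero combination of the first rows is supported on the first block of columns, then
  swapping blocks produces equally many matrices for which it is supported on another given block.
  The combination does not vanish, so the cases are disjoint.\<close>

lemma card_row_comb_supported_le:
  fixes m :: int and v :: "nat \<Rightarrow> int"
  assumes "s \<le> n" "p < s" "\<not> m dvd v p"
  shows "n div s * card {A \<in> residue_GL m n. \<forall>j\<in>{s..<n}. m dvd row_comb s v A j}
    \<le> card (residue_GL m n)"
proof -
  let ?b = "\<lambda>k. {k * s..<k * s + s}"
  define E where "E k = {A \<in> residue_GL m n. \<forall>j\<in>{..<n} - ?b k. m dvd row_comb s v A j}" for k
  have E0: "{A \<in> residue_GL m n. \<forall>j\<in>{s..<n}. m dvd row_comb s v A j} = E 0"
    by (auto simp: E_def)
  have finE: "finite (E k)" for k by (simp add: E_def finite_residue_GL)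
  \<comment> \<open>At least \<open>n div s\<close> full blocks of length \<open>s\<close> fit into
    \<open>n\<close> columns.\<close>
  have le: "k * s + s \<le> n" if "k < n div s" for k
  proof -
    have "Suc k * s \<le> n div s * s" using that by (intro mult_right_mono) auto
    also have "\<dots> \<le> n" by simp
    finally show ?thesis by simp
  qed
  have card_le: "card (E 0) \<le> card (E k)" if "k < n div s" for k
  proof (rule card_inj_on_le[OF _ _ finE])
    define t where "t = k * s"
    let ?p = "swap_blocks s t"
    let ?T = "\<lambda>A. mat n n (\<lambda>(i, j). A $$ (i, ?p j))"
    have t: "t = 0 \<or> s \<le> t" by (cases k) (auto simp: t_def)
    then have p: "?p permutes {0..<n}"
      using le[OF that] by (intro swap_blocks_permutes) (auto simp: t_def)
    have pn: "?p j < n \<longleftrightarrow> j < n" for j using permutes_in_image[OF p, of j] by simp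
    show "inj_on ?T (E 0)"
    proof
      fix A B assume A: "A \<in> E 0" and B: "B \<in> E 0" and eq: "?T A = ?T B"
      have "A $$ (i, j) = B $$ (i, j)" if "i < n" "j < n" for i j
        using arg_cong[OF eq, of "\<lambda>M. M $$ (i, inv_into UNIV ?p j)"] that pn[of "inv_into UNIV ?p j"]
          permutes_inverses(1)[OF p] by simp
      then show "A = B" using A B by (intro eq_matI) (auto simp: E_def dest!: residue_GL_carrier)
    qed
    show "?T ` E 0 \<subseteq> E k"
    proof
      fix B assume "B \<in> ?T ` E 0"
      then obtain A where A: "A \<in> E 0" and B: "B = ?T A" by blast
      have "m dvd row_comb s v B j" if "j \<in> {..<n} - ?b k" for j
      proof -
        have "row_comb s v B j = row_comb s v A (?p j)"
          using that assms by (simp add: B row_comb_def)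
        \<comment> \<open>The swap carries block \<open>k\<close> onto block 0, hence the complement
          of block \<open>k\<close> into the complement of block 0.\<close>
        moreover have "?p j \<in> {..<n} - ?b 0"
          using that pn[of j] t unfolding t_def[symmetric] by (auto simp: swap_blocks_def split: if_splits)
        ultimately show ?thesis using A by (simp add: E_def)
      qed
      moreover have "B \<in> residue_GL m n"
        using A p unfolding B E_def by (intro permute_cols_in_residue_GL) auto
      ultimately show "B \<in> E k" by (simp add: E_def)
    qed
  qed
  \<comment> \<open>A combination supported on two disjoint blocks vanishes modulo \<open>m\<close>
    everywhere, which invertibility of \<open>A\<close> forbids.\<close>
  have disj: "E k \<inter> E l = {}" if "k \<noteq> l" for k l
  proof (rule ccontr)
    assume "E k \<inter> E l \<noteq> {}"
    then obtain A where A: "A \<in> E k" "A \<in> E l" by blast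
    have "?b k \<inter> ?b l = {}"
    proof -
      have "j div s = i" if "j \<in> ?b i" for i j
        using that by (intro div_nat_eqI) (auto simp: mult.commute)
      then show ?thesis using that by blast
    qed
    then have "m dvd row_comb s v A j" if "j < n" for j
      using A that by (auto simp: E_def)
    then have "m dvd v p"
      using A assms by (intro dvd_coeff_if_dvd_row_comb[of A n m s v p])
        (auto simp: E_def residue_GL_def residue_mats_def)
    then show False using assms by simp
  qed
  have "n div s * card (E 0) = (\<Sum>k<n div s. card (E 0))" by simp
  also have "\<dots> \<le> (\<Sum>k<n div s. card (E k))" using card_le by (intro sum_mono) auto
  also have "\<dots> = card (\<Union>k<n div s. E k)"
    using disj finE by (intro card_UN_disjoint[symmetric]) auto
  also have "\<dots> \<le> card (residue_GL m n)"
    by (intro card_mono finite_residue_GL) (auto simp: E_def)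
  finally show ?thesis unfolding E0 .
qed

text \<open>For representatives, equality of corners is congruence of their entries, so the Fourier
  estimate applies with the \<open>s\<close> by \<open>s\<close> square as index set and the bound
  \<open>card ?G / (n div s)\<close> for every nonzero frequency.\<close>

lemma card_residue_GL_corner_approx:
  fixes m :: int
  assumes "m > 0" "0 < s" "s \<le> n" "B \<in> residue_mats m s"
  shows "\<bar>of_int m ^ (s * s) * real (card {A \<in> residue_GL m n. corner s A = B}) - real (card (residue_GL m n))\<bar>
    \<le> of_int m ^ (s * s) * (card (residue_GL m n) / real (n div s))"
proof -
  let ?G = "residue_GL m n" and ?I = "{..<s} \<times> {..<s}"
  have pos: "n div s > 0" using assms by (simp add: div_greater_zero_iff)
  have "corner s A = B \<longleftrightarrow> (\<forall>x\<in>?I. [A $$ x = B $$ x] (mod m))" if A: "A \<in> ?G" for A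
  proof -
    have "A $$ (i, j) \<in> {0..<m}" "B $$ (i, j) \<in> {0..<m}" if "i < s" "j < s" for i j
      using residue_GL_entry[OF A, of i j] assms(3,4) that by (auto simp: residue_mats_def)
    then have "(\<forall>x\<in>?I. [A $$ x = B $$ x] (mod m)) \<longleftrightarrow> (\<forall>i<s. \<forall>j<s. A $$ (i, j) = B $$ (i, j))"
      by (auto simp: cong_def)
    also have "\<dots> \<longleftrightarrow> corner s A = B"
    proof
      show "corner s A = B" if "\<forall>i<s. \<forall>j<s. A $$ (i, j) = B $$ (i, j)"
        using that assms(4) by (intro eq_matI) (auto simp: corner_def residue_mats_def)
      show "\<forall>i<s. \<forall>j<s. A $$ (i, j) = B $$ (i, j)" if "corner s A = B"
        unfolding that[symmetric] by (simp add: corner_def)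
    qed
    finally show ?thesis ..
  qed
  then have eq: "{A \<in> ?G. corner s A = B} = {A \<in> ?G. \<forall>x\<in>?I. [A $$ x = B $$ x] (mod m)}"
    by blast
  have "norm (\<Sum>A\<in>?G. root_char m (\<Sum>x\<in>?I. V x * A $$ x)) \<le> card ?G / real (n div s)"
    if V: "V \<in> ?I \<rightarrow>\<^sub>E {0..<m}" "\<exists>x\<in>?I. V x \<noteq> 0" for V
  proof -
    \<comment> \<open>Column \<open>q\<close> of \<open>V\<close> supplies the coefficients of the
      row combination; its entry at \<open>p\<close> is nonzero modulo \<open>m\<close>.\<close>
    obtain p q where pq: "p < s" "q < s" "V (p, q) \<noteq> 0" using V(2) by auto
    have "V (p, q) \<in> {0..<m}" using PiE_mem[OF V(1), of "(p, q)"] pq by simp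
    then have "\<not> m dvd V (p, q)" using pq(3) zdvd_imp_le[of m "V (p, q)"] by auto
    then have "n div s * card {A \<in> ?G. \<forall>j\<in>{s..<n}. m dvd row_comb s (\<lambda>i. V (i, q)) A j} \<le> card ?G"
      using card_row_comb_supported_le[of s n p m "\<lambda>i. V (i, q)"] assms(3) pq(1) by simp
    then have "card {A \<in> ?G. \<forall>j\<in>{s..<n}. m dvd row_comb s (\<lambda>i. V (i, q)) A j} \<le> card ?G / real (n div s)"
      using pos by (simp add: pos_le_divide_eq mult.commute flip: of_nat_mult)
    then show ?thesis
      using norm_sum_residue_GL_root_char_le[OF assms(1,3) pq(2), of V] by linarith
  qed
  then show ?thesis
    using card_cong_approx[of m ?I ?G "\<lambda>A x. A $$ x" "card ?G / real (n div s)" "\<lambda>x. B $$ x"]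
      assms(1) finite_residue_GL unfolding eq by (simp add: card_cartesian_product)
qed

section \<open>Reduction modulo m\<close>

lemma ring_hom_ZMod: "ZMod m \<in> Ring.ring_hom \<Z> (ZFact m)"
proof -
  have "ideal (Idl\<^bsub>\<Z>\<^esub> {m}) \<Z>" by (rule int.genideal_ideal) simp
  from ideal.rcos_ring_hom[OF this] show ?thesis
    unfolding ZFact_def ZMod_def[abs_def] .
qed

lemma ZMod_eq_iff: "ZMod m a = ZMod m b \<longleftrightarrow> [a = b] (mod m)"
  using ZMod_imp_zmod zmod_imp_ZMod unfolding cong_def by blast

lemma carrier_ZFact: "carrier (ZFact m) = range (ZMod m)"
  by (auto simp: ZFact_defs A_RCOSETS_defs ZMod_def a_r_coset_def r_coset_def)

lemma bij_betw_ZMod: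
  assumes "m > 0"
  shows "bij_betw (ZMod m) {0..<m} (carrier (ZFact m))"
proof (rule bij_betw_imageI)
  show "inj_on (ZMod m) {0..<m}" by (auto simp: inj_on_def ZMod_eq_iff cong_def)
  show "ZMod m ` {0..<m} = carrier (ZFact m)"
  proof
    show "carrier (ZFact m) \<subseteq> ZMod m ` {0..<m}"
    proof
      fix x assume "x \<in> carrier (ZFact m)"
      then obtain a where "x = ZMod m (a mod m)" using ZMod_mod unfolding carrier_ZFact by blast
      then show "x \<in> ZMod m ` {0..<m}" using assms by simp
    qed
  qed (auto simp: carrier_ZFact)
qed

text \<open>Every class has an integer representative, so an inverse in the quotient is an integer
  \<open>b\<close> with \<open>a * b\<close> congruent to 1, which exists exactly for coprime
  \<open>a\<close> and \<open>m\<close>.\<close>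

lemma ZMod_Units_iff: "ZMod m a \<in> Units (ZFact m) \<longleftrightarrow> coprime a m"
proof -
  interpret h: ring_hom_cring \<Z> "ZFact m" "ZMod m"
    by (intro ring_hom_cringI int_is_cring ZFact_is_cring ring_hom_cring.intro
        ring_hom_cring_axioms.intro ring_hom_ZMod)
  have "ZMod m a \<in> Units (ZFact m) \<longleftrightarrow> (\<exists>b. ZMod m a \<otimes>\<^bsub>ZFact m\<^esub> ZMod m b = \<one>\<^bsub>ZFact m\<^esub>)"
    unfolding Units_def carrier_ZFact by (auto simp: h.S.m_comm carrier_ZFact)
  also have "\<dots> \<longleftrightarrow> (\<exists>b. [a * b = 1] (mod m))"
    using h.hom_mult h.hom_one by (simp add: ZMod_eq_iff[symmetric])
  also have "\<dots> \<longleftrightarrow> coprime a m" by (simp add: coprime_iff_invertible_int)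
  finally show ?thesis .
qed

text \<open>Reduction is a ring homomorphism and therefore commutes with the Leibniz
  formula.\<close>

lemma ring_det_ZMod:
  assumes "A \<in> carrier_mat n n"
  shows "ring_det (ZFact m) (map_mat (ZMod m) A) = ZMod m (Determinant.det A)"
proof -
  interpret h: ring_hom_cring \<Z> "ZFact m" "ZMod m"
    by (intro ring_hom_cringI int_is_cring ZFact_is_cring ring_hom_cring.intro
        ring_hom_cring_axioms.intro ring_hom_ZMod)
  \<comment> \<open>The sign is 1 or -1, so the integer multiple is the identity or the additive
    inverse.\<close>
  have sgn: "[sign p] \<cdot>\<^bsub>ZFact m\<^esub> ZMod m a = ZMod m (sign p * a)" for p :: "nat \<Rightarrow> nat" and a
  proof (cases "sign p = 1")
    case True
    then show ?thesis by (simp add: h.S.add.int_pow_1)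
  next
    case False
    then have "sign p = -1" by (simp add: sign_def split: if_splits)
    then show ?thesis
      using h.hom_a_inv[of a] by (simp add: h.S.add.int_pow_neg h.S.add.int_pow_1)
  qed
  have "ring_det (ZFact m) (map_mat (ZMod m) A) =
      (\<Oplus>\<^bsub>ZFact m\<^esub>p\<in>{p. p permutes {0..<n}}. ZMod m (sign p * (\<Prod>i=0..<n. A $$ (i, p i))))"
    unfolding ring_det_def
  proof (intro h.S.finsum_cong')
    fix p assume "p \<in> {p. p permutes {0..<n}}"
    then have p: "p i < n" if "i < n" for i using permutes_in_image[of p "{0..<n}" i] that by simp
    have "(\<Otimes>\<^bsub>ZFact m\<^esub>i\<in>{0..<n}. map_mat (ZMod m) A $$ (i, p i)) =
        (\<Otimes>\<^bsub>ZFact m\<^esub>i\<in>{0..<n}. (ZMod m \<circ> (\<lambda>i. A $$ (i, p i))) i)"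
      using assms p by (intro h.S.finprod_cong') auto
    also have "\<dots> = ZMod m (\<Prod>i=0..<n. A $$ (i, p i))"
      using h.hom_finprod[of "\<lambda>i. A $$ (i, p i)" "{0..<n}"] by simp
    finally show "[sign p] \<cdot>\<^bsub>ZFact m\<^esub> (\<Otimes>\<^bsub>ZFact m\<^esub>i\<in>{0..<dim_row (map_mat (ZMod m) A)}.
        map_mat (ZMod m) A $$ (i, p i)) = ZMod m (sign p * (\<Prod>i=0..<n. A $$ (i, p i)))"
      using assms by (simp add: sgn)
  qed (use assms in auto)
  also have "\<dots> = ZMod m (\<Sum>p\<in>{p. p permutes {0..<n}}. sign p * (\<Prod>i=0..<n. A $$ (i, p i)))"
    using h.hom_finsum[of "\<lambda>p. sign p * (\<Prod>i=0..<n. A $$ (i, p i))" "{p. p permutes {0..<n}}"]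
    by (simp add: o_def)
  also have "\<dots> = ZMod m (Determinant.det A)"
    by (simp add: det_def'[OF assms])
  finally show ?thesis .
qed

lemma bij_betw_residue_mats:
  assumes "m > 0"
  shows "bij_betw (map_mat (ZMod m)) (residue_mats m n) (matrices (ZFact m) n)"
proof (rule bij_betw_byWitness[where f' = "map_mat (inv_into {0..<m} (ZMod m))"])
  note bij = bij_betw_ZMod[OF assms]
  show "\<forall>A\<in>residue_mats m n. map_mat (inv_into {0..<m} (ZMod m)) (map_mat (ZMod m) A) = A"
    using bij_betw_inv_into_left[OF bij] by (auto simp: residue_mats_def intro!: eq_matI)
  show "\<forall>A\<in>matrices (ZFact m) n. map_mat (ZMod m) (map_mat (inv_into {0..<m} (ZMod m)) A) = A"
    using bij_betw_inv_into_right[OF bij] by (auto simp: matrices_def intro!: eq_matI)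
  show "map_mat (ZMod m) ` residue_mats m n \<subseteq> matrices (ZFact m) n"
    by (auto simp: residue_mats_def matrices_def carrier_ZFact)
  show "map_mat (inv_into {0..<m} (ZMod m)) ` matrices (ZFact m) n \<subseteq> residue_mats m n"
    using bij_betwE[OF bij_betw_inv_into[OF bij]] by (fastforce simp: residue_mats_def matrices_def)
qed

lemma bij_betw_residue_GL:
  assumes "m > 0"
  shows "bij_betw (map_mat (ZMod m)) (residue_GL m n) (GL (ZFact m) n)"
proof -
  have "ring_det (ZFact m) (map_mat (ZMod m) A) \<in> Units (ZFact m) \<longleftrightarrow> coprime (Determinant.det A) m"
    if "A \<in> residue_mats m n" for A
    using that by (simp add: ring_det_ZMod[of A n] ZMod_Units_iff residue_mats_def)
  then have "map_mat (ZMod m) ` residue_GL m n = GL (ZFact m) n"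
    using bij_betw_imp_surj_on[OF bij_betw_residue_mats[OF assms, of n], symmetric]
    by (auto simp: residue_GL_def GL_def)
  then show ?thesis
    using bij_betw_subset[OF bij_betw_residue_mats[OF assms, of n], of "residue_GL m n"]
    by (auto simp: residue_GL_def)
qed

section \<open>Convergence of the corner\<close>

lemma residue_GL_nonempty:
  assumes "m > 0"
  shows "residue_GL m n \<noteq> {}"
  \<comment> \<open>The identity matrix is reduced first because for \<open>m = 1\<close> its
    diagonal entry 1 is not a representative.\<close>
  using mod_mat_in_residue_GL[OF assms, of "1\<^sub>m n" n] by auto

lemma corner_map_mat:
  assumes "A \<in> carrier_mat n n" "s \<le> n"
  shows "corner s (map_mat f A) = map_mat f (corner s A)"
  using assms by (auto simp: corner_def)

lemma corner_in_matrices: "A \<in> matrices R n \<Longrightarrow> s \<le> n \<Longrightarrow> corner s A \<in> matrices R s"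
  by (auto simp: matrices_def corner_def)

lemma finite_matrices_ZFact: "m > 0 \<Longrightarrow> finite (matrices (ZFact m) n)"
  using bij_betw_finite[OF bij_betw_residue_mats] finite_residue_mats by blast

lemma finite_GL_ZFact: "m > 0 \<Longrightarrow> finite (GL (ZFact m) n)"
  using bij_betw_finite[OF bij_betw_residue_GL] finite_residue_GL by blast

text \<open>Dividing the counting estimate by \<open>m ^ (s * s)\<close> times the group order
  leaves an error of \<open>1 / (n div s)\<close>, which tends to 0 for fixed
  \<open>s\<close>.\<close>

lemma corner_probability_tendsto:
  fixes m :: int
  assumes "m > 0" "0 < s" "B \<in> matrices (ZFact m) s"
  shows "(\<lambda>n. card {A \<in> GL (ZFact m) n. corner s A = B} / card (GL (ZFact m) n))
    \<longlonglongrightarrow> 1 / card (matrices (ZFact m) s)"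
proof -
  let ?h = "map_mat (ZMod m)"
  let ?p = "\<lambda>n. card {A \<in> GL (ZFact m) n. corner s A = B} / card (GL (ZFact m) n)"
  obtain B' where B': "B' \<in> residue_mats m s" "B = ?h B'"
    using assms(3) bij_betw_imp_surj_on[OF bij_betw_residue_mats[OF assms(1)], of s] by blast
  have card_s: "real (card (matrices (ZFact m) s)) = of_int m ^ (s * s)"
    unfolding bij_betw_same_card[OF bij_betw_residue_mats[OF assms(1), of s], symmetric]
      card_residue_mats[OF assms(1)] using assms(1) by simp
  have bound: "\<bar>?p n - 1 / of_int m ^ (s * s)\<bar> \<le> 1 / real (n div s)" if "s \<le> n" for n
  proof -
    let ?c = "card {A \<in> residue_GL m n. corner s A = B'}" and ?g = "card (residue_GL m n)"
    let ?q = "of_int m ^ (s * s) :: real"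
    note bij = bij_betw_residue_GL[OF assms(1), of n]
    have g: "?g > 0"
      using residue_GL_nonempty[OF assms(1)] finite_residue_GL by (simp add: card_gt_0_iff)
    have q: "?q > 0" using assms(1) by simp
    then have qg: "?q * real ?g > 0" using g by (intro mult_pos_pos) simp_all
    \<comment> \<open>Taking corners commutes with reduction, and reduction is injective on matrices
      of representatives.\<close>
    have corner: "corner s (?h A) = B \<longleftrightarrow> corner s A = B'" if A: "A \<in> residue_GL m n" for A
    proof -
      have "corner s A \<in> residue_mats m s"
        using residue_GL_entry[OF A] \<open>s \<le> n\<close> by (auto simp: corner_def residue_mats_def)
      then show ?thesis
        unfolding corner_map_mat[OF residue_GL_carrier[OF A] \<open>s \<le> n\<close>] B'(2)
        using B'(1) bij_betw_imp_inj_on[OF bij_betw_residue_mats[OF assms(1), of s]]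
        by (simp add: inj_on_eq_iff)
    qed
    have "?h ` {A \<in> residue_GL m n. corner s A = B'} = {A \<in> GL (ZFact m) n. corner s A = B}"
      using corner unfolding bij_betw_imp_surj_on[OF bij, symmetric] by blast
    then have "card {A \<in> GL (ZFact m) n. corner s A = B} = ?c"
      using card_image[OF inj_on_subset[OF bij_betw_imp_inj_on[OF bij]],
          of "{A \<in> residue_GL m n. corner s A = B'}"] by auto
    then have p: "?p n = ?c / ?g" using bij_betw_same_card[OF bij] by simp
    have "?q * ?g * \<bar>?c / ?g - 1 / ?q\<bar> = \<bar>?q * ?g * (?c / ?g - 1 / ?q)\<bar>"
      using qg by (intro abs_mult_pos' less_imp_le)
    also have "?q * ?g * (?c / ?g - 1 / ?q) = ?q * ?c - ?g"
      using assms(1) g by (simp add: field_simps)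
    also have "\<bar>\<dots>\<bar> \<le> ?q * ?g * (1 / real (n div s))"
      using card_residue_GL_corner_approx[OF assms(1,2) that B'(1)] by simp
    finally show ?thesis unfolding p using qg by (simp only: mult_le_cancel_left_pos)
  qed
  have "filterlim (\<lambda>n. n div s) at_top sequentially"
    unfolding filterlim_at_top
  proof
    fix k
    show "eventually (\<lambda>n. k \<le> n div s) sequentially"
      using eventually_ge_at_top[of "k * s"]
      by (rule eventually_mono) (simp add: less_eq_div_iff_mult_less_eq assms(2))
  qed
  then have "(\<lambda>n. 1 / real (n div s)) \<longlonglongrightarrow> 0"
    by (intro tendsto_divide_0[OF tendsto_const] filterlim_at_top_imp_at_infinity
        filterlim_compose[OF filterlim_real_sequentially])
  then have "(\<lambda>n. ?p n - 1 / of_int m ^ (s * s)) \<longlonglongrightarrow> 0"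
    by (rule Lim_null_comparison[rotated])
      (rule eventually_mono[OF eventually_ge_at_top[of s]], simp add: bound)
  then show ?thesis unfolding card_s by (simp add: LIM_zero_iff)
qed

text \<open>On a finite discrete space an expectation is a finite sum weighted by point
  probabilities, so weak convergence follows from the convergence of each point probability.\<close>

theorem theorem3p1:
  fixes m S :: nat
    and P :: "nat \<Rightarrow> 'w measure"
    and Y :: "nat \<Rightarrow> 'w \<Rightarrow> int set mat"
  assumes "m > 0" and "S > 0"
    and "\<And>N. N \<ge> S \<Longrightarrow> prob_space (P N)"
    and "\<And>N. N \<ge> S \<Longrightarrow> Y N \<in> measurable (P N) (count_space (GL (ZFact (int m)) N))"
    and "\<And>N. N \<ge> S \<Longrightarrow>
      distr (P N) (count_space (GL (ZFact (int m)) N)) (Y N) =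
        uniform_count_measure (GL (ZFact (int m)) N)"
  shows "weak_conv_top (discrete_topology (matrices (ZFact (int m)) S))
    (\<lambda>N. distr (P N) (count_space (matrices (ZFact (int m)) S)) (\<lambda>\<omega>. corner S (Y N \<omega>)))
    (uniform_count_measure (matrices (ZFact (int m)) S))"
  unfolding weak_conv_top_def
proof (intro allI impI)
  fix f :: "int set mat \<Rightarrow> real"
  let ?R = "ZFact (int m)"
  let ?M = "matrices ?R S" and ?G = "\<lambda>N. GL ?R N"
  let ?d = "\<lambda>N. distr (P N) (count_space ?M) (\<lambda>\<omega>. corner S (Y N \<omega>))"
  have m: "int m > 0" using assms(1) by simp
  have eq: "(\<integral>x. f x \<partial>?d N) = (\<Sum>B\<in>?M. f B * (card {A \<in> ?G N. corner S A = B} / card (?G N)))"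
    if N: "N \<ge> S" for N
  proof -
    have corner: "corner S \<in> ?G N \<rightarrow> ?M"
      using N by (auto simp: GL_def intro: corner_in_matrices)
    \<comment> \<open>The law of the corner is the image of the law of \<open>Y N\<close>, which is
      uniform.\<close>
    have "?d N = distr (distr (P N) (count_space (?G N)) (Y N)) (count_space ?M) (corner S)"
      using corner by (subst distr_distr[OF _ assms(4)[OF N]]) (auto simp: o_def)
    then have "(\<integral>x. f x \<partial>?d N) = (\<integral>x. f x \<partial>distr (uniform_count_measure (?G N)) (count_space ?M) (corner S))"
      unfolding assms(5)[OF N] by simp
    also have "\<dots> = (\<integral>A. f (corner S A) \<partial>uniform_count_measure (?G N))"
      using corner by (intro integral_distr)
        (auto simp: measurable_def uniform_count_measure_def space_point_measure sets_point_measure)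
    also have "\<dots> = (\<Sum>A\<in>?G N. f (corner S A)) / card (?G N)"
      by (rule integral_uniform_count_measure[OF finite_GL_ZFact[OF m]])
    \<comment> \<open>The group is partitioned into the fibres of the corner map.\<close>
    also have "(\<Sum>A\<in>?G N. f (corner S A)) = (\<Sum>B\<in>?M. \<Sum>A\<in>{A \<in> ?G N. corner S A = B}. f (corner S A))"
      using corner by (intro sum.group[symmetric] finite_GL_ZFact finite_matrices_ZFact m) auto
    also have "\<dots> = (\<Sum>B\<in>?M. f B * card {A \<in> ?G N. corner S A = B})"
      by (intro sum.cong) auto
    finally show ?thesis by (simp add: sum_divide_distrib)
  qed
  have "(\<lambda>N. \<Sum>B\<in>?M. f B * (card {A \<in> ?G N. corner S A = B} / card (?G N)))
      \<longlonglongrightarrow> (\<Sum>B\<in>?M. f B * (1 / card ?M))"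
    by (intro tendsto_sum tendsto_mult tendsto_const corner_probability_tendsto m assms(2))
  moreover have "(\<Sum>B\<in>?M. f B * (1 / card ?M)) = (\<integral>x. f x \<partial>uniform_count_measure ?M)"
    by (simp add: integral_uniform_count_measure[OF finite_matrices_ZFact[OF m]] sum_divide_distrib)
  \<comment> \<open>The formula for the integral is available from \<open>N = S\<close> on, which is
    enough for the limit.\<close>
  moreover have "eventually (\<lambda>N. (\<Sum>B\<in>?M. f B * (card {A \<in> ?G N. corner S A = B} / card (?G N))) =
      (\<integral>x. f x \<partial>?d N)) sequentially"
    using eventually_ge_at_top[of S] by eventually_elim (simp add: eq)
  ultimately show "(\<lambda>N. \<integral>x. f x \<partial>?d N) \<longlonglongrightarrow> (\<integral>x. f x \<partial>uniform_count_measure ?M)"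
    by (simp add: tendsto_cong)
qed

end
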